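(* For every positive integer $n$, the consumption ordering $\ge_c$ is a partial order on the set of partitions of $n$ (it is reflexive, transitive and antisymmetric).
   Context: Let $[n]=\{1,\ldots,n\}$. A set partition $[n]=A_1\cup\cdots\cup A_k$ is said to distinguish a subgroup $H$ of $S_n$ if the only element of $H$ that maps each $A_i$ to itself is the identity. A subgroup $H\le S_n$ consumes a partition $\lambda\vdash n$ if there is a set partition of $[n]$ whose block sizes, in decreasing order, are the parts of $\lambda$, and which distinguishes $H$. The consumption ordering is defined on partitions of $n$ by: $\lambda\ge_c\mu$ if every subgroup $H\le S_n$ that consumes $\lambda$ also consumes $\mu$. *)

theory Defs
  imports
    "HOL-Algebra.Sym_Groups"
    "HOL-Library.Disjoint_Sets"
    "HOL-Library.Multiset"
begin

text \<open>An integer partition is the multiset of its (positive) parts; this is the same data as the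
  list of parts in decreasing order.\<close>

definition int_partitions :: "nat \<Rightarrow> nat multiset set"
  where "int_partitions n = {L. 0 \<notin># L \<and> sum_mset L = n}"

definition block_sizes :: "'a set set \<Rightarrow> nat multiset"
  where "block_sizes P = image_mset card (mset_set P)"

text \<open>``Maps each block to itself'' is meant setwise.\<close>

definition distinguishes :: "'a set set \<Rightarrow> ('a \<Rightarrow> 'a) set \<Rightarrow> bool"
  where "distinguishes P H \<longleftrightarrow> (\<forall>h\<in>H. (\<forall>A\<in>P. h ` A = A) \<longrightarrow> h = id)"

definition consumes :: "nat \<Rightarrow> (nat \<Rightarrow> nat) set \<Rightarrow> nat multiset \<Rightarrow> bool"
  where "consumes n H L \<longleftrightarrow>
    (\<exists>P. partition_on {1..n} P \<and> block_sizes P = L \<and> distinguishes P H)"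

definition consumption_ge :: "nat \<Rightarrow> nat multiset \<Rightarrow> nat multiset \<Rightarrow> bool"
  where "consumption_ge n L M \<longleftrightarrow>
    (\<forall>H. subgroup H (sym_group n) \<longrightarrow> consumes n H L \<longrightarrow> consumes n H M)"

end

theory Submission
  imports Defs
begin

text \<open>Fill the rows of the Young diagram of L with 1, ..., n, let P be the partition into rows, and
  let H be the group of permutations preserving every column. A row and a column share at most one
  cell, so H consumes L. If H also consumes M, via a partition R, then no two elements of a column
  lie in the same block of R, for otherwise H would contain their transposition. Counting the cells
  in the first k columns therefore shows that the sum of min a k over the parts a of L is at most
  the corresponding sum for M. If L and M consume each other, these sums agree for every k, and
  their successive differences count the parts exceeding k.\<close>

lemma ex_partition_on_block_sizes:
  assumes "finite S" "0 \<notin># L" "sum_mset L = card S"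
  shows "\<exists>P. partition_on S P \<and> block_sizes P = L"
  using assms
proof (induction L arbitrary: S)
  case empty
  then show ?case by (simp add: block_sizes_def partition_on_empty)
next
  case (add a L)
  then have "a \<le> card S" by (metis le_add1 sum_mset.add_mset)
  then obtain T where T: "T \<subseteq> S" "card T = a" "finite T"
    using add.prems(1) by (meson obtain_subset_with_card_n)
  have "T \<noteq> {}" using T add.prems by auto
  have "sum_mset L = card (S - T)"
    using T add.prems by (simp add: card_Diff_subset)
  then obtain P where P: "partition_on (S - T) P" "block_sizes P = L"
    using add.IH[of "S - T"] add.prems by auto
  \<comment> \<open>The blocks of \<open>P\<close> lie in \<open>S - T\<close>, so the nonempty
    \<open>T\<close> is a new block. This is where positivity of the parts enters:
    \<open>mset_set\<close> then gains exactly one element.\<close>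
  have "T \<notin> P" using P(1) \<open>T \<noteq> {}\<close> by (auto simp: partition_on_def)
  have "finite P" using P(1) add.prems(1) finite_elements by blast
  have "partition_on S (insert T P)"
    using P(1) T(1) \<open>T \<noteq> {}\<close> by (auto simp: partition_on_def disjoint_def)
  moreover have "block_sizes (insert T P) = add_mset a L"
    using \<open>T \<notin> P\<close> \<open>finite P\<close> P(2) T(2) by (simp add: block_sizes_def)
  ultimately show ?case by blast
qed

text \<open>Supplies the column index: \<open>c\<close> numbers the cells of each row from 0, and
  its fibers are the columns.\<close>

lemma ex_bij_betw_blocks:
  assumes "finite S" "partition_on S P"
  shows "\<exists>c. \<forall>A\<in>P. bij_betw c A {0..<card A}"
proof -
  have "\<forall>A\<in>P. \<exists>f. bij_betw f A {0..<card A}"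
    using assms ex_bij_betw_finite_nat by (metis Union_upper finite_subset partition_onD1)
  then obtain f where f: "\<And>A. A \<in> P \<Longrightarrow> bij_betw (f A) A {0..<card A}" by metis
  \<comment> \<open>Glues the numberings of the single blocks; disjointness of the blocks makes the
    description unique.\<close>
  define c where "c x = f (THE A. A \<in> P \<and> x \<in> A) x" for x
  have "c x = f A x" if "A \<in> P" "x \<in> A" for A x
  proof -
    have "(THE A. A \<in> P \<and> x \<in> A) = A"
      using that assms(2) by (intro the_equality) (auto simp: partition_on_def disjoint_def)
    then show ?thesis by (simp add: c_def)
  qed
  then have "bij_betw c A {0..<card A}" if "A \<in> P" for A
    using f[OF that] that by (metis bij_betw_cong)
  then show ?thesis by blast
qed

text \<open>For infinite \<open>P\<close> both sides are 0, since \<open>mset_set P\<close> is then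
  empty.\<close>

lemma sum_mset_block_sizes: "(\<Sum>a\<in>#block_sizes P. f a) = (\<Sum>A\<in>P. f (card A))"
  by (simp add: block_sizes_def sum_unfold_sum_mset multiset.map_comp comp_def)

lemma card_partition_on_Collect:
  assumes "finite S" "partition_on S P"
  shows "card {x \<in> S. Q x} = (\<Sum>A\<in>P. card {x \<in> A. Q x})"
proof -
  have "{x \<in> S. Q x} = (\<Union>A\<in>P. {x \<in> A. Q x})"
    using assms(2) by (auto simp: partition_on_def)
  moreover have "card (\<Union>A\<in>P. {x \<in> A. Q x}) = (\<Sum>A\<in>P. card {x \<in> A. Q x})"
  proof (rule card_UN_disjoint)
    show "finite P" using assms finite_elements by blast
    show "\<forall>A\<in>P. finite {x \<in> A. Q x}"
      using assms by (metis (no_types, lifting) Union_upper finite_subset partition_onD1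
          mem_Collect_eq subsetI)
    show "\<forall>A\<in>P. \<forall>B\<in>P. A \<noteq> B \<longrightarrow> {x \<in> A. Q x} \<inter> {x \<in> B. Q x} = {}"
      using assms(2) by (auto simp: partition_on_def disjoint_def)
  qed
  ultimately show ?thesis by simp
qed

text \<open>The Young subgroup of the partition of \<open>{1..n}\<close> into fibers of
  \<open>c\<close>; for the column index it is the column stabilizer.\<close>

definition fiber_group :: "nat \<Rightarrow> (nat \<Rightarrow> 'a) \<Rightarrow> (nat \<Rightarrow> nat) set"
  where "fiber_group n c = {h. h permutes {1..n} \<and> (\<forall>x\<in>{1..n}. c (h x) = c x)}"

lemma subgroup_fiber_group: "subgroup (fiber_group n c) (sym_group n)"
proof (rule group.subgroupI[OF sym_group_is_group])
  show "fiber_group n c \<subseteq> carrier (sym_group n)"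
    by (auto simp: fiber_group_def sym_group_def)
  show "fiber_group n c \<noteq> {}"
    using permutes_id[of "{1..n}"] by (auto simp: fiber_group_def intro!: exI[of _ id])
next
  fix h assume h: "h \<in> fiber_group n c"
  then have p: "h permutes {1..n}" by (simp add: fiber_group_def)
  have "c (inv' h x) = c x" if "x \<in> {1..n}" for x
  proof -
    have "inv' h x \<in> {1..n}" using that p by (metis permutes_in_image permutes_inv)
    then have "c (h (inv' h x)) = c (inv' h x)" using h by (auto simp: fiber_group_def)
    then show ?thesis using p by (simp add: permutes_inverses)
  qed
  then show "inv\<^bsub>sym_group n\<^esub> h \<in> fiber_group n c"
    using p by (simp add: fiber_group_def sym_group_inv_equality sym_group_carrier permutes_inv)
next
  fix g h assume "g \<in> fiber_group n c" "h \<in> fiber_group n c"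
  then show "g \<otimes>\<^bsub>sym_group n\<^esub> h \<in> fiber_group n c"
    by (auto simp: fiber_group_def sym_group_def permutes_compose)
       (metis atLeastAtMost_iff permutes_in_image One_nat_def)
qed

text \<open>Two points of one block with equal \<open>c\<close> can be swapped inside the group.
  Conversely, an element preserving both blocks and \<open>c\<close> must fix every point if
  \<open>c\<close> separates the points of each block.\<close>

lemma distinguishes_fiber_group_iff:
  assumes "partition_on {1..n} P"
  shows "distinguishes P (fiber_group n c) \<longleftrightarrow> (\<forall>A\<in>P. inj_on c A)"
proof
  assume d: "distinguishes P (fiber_group n c)"
  show "\<forall>A\<in>P. inj_on c A"
  proof (intro ballI inj_onI, rule ccontr)
    fix A x y assume A: "A \<in> P" "x \<in> A" "y \<in> A" and c: "c x = c y" and "x \<noteq> y"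
    define h where "h = transpose x y"
    have xy: "x \<in> {1..n}" "y \<in> {1..n}" using A assms by (auto simp: partition_on_def)
    have "h \<in> fiber_group n c"
      using xy c permutes_swap_id[OF xy]
      by (auto simp: fiber_group_def h_def transpose_def)
    moreover have "h ` B = B" if "B \<in> P" for B
    proof -
      \<comment> \<open>Both points lie in \<open>A\<close>, and distinct blocks are
        disjoint.\<close>
      have "x \<in> B \<longleftrightarrow> y \<in> B" using that A assms by (auto simp: partition_on_def disjoint_def)
      then show ?thesis by (simp add: h_def)
    qed
    ultimately have "h = id" using d by (auto simp: distinguishes_def)
    then show False using \<open>x \<noteq> y\<close> by (metis h_def id_apply transpose_apply_first)
  qed
next
  assume inj: "\<forall>A\<in>P. inj_on c A"
  show "distinguishes P (fiber_group n c)"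
    unfolding distinguishes_def
  proof (intro ballI impI ext)
    fix h x assume h: "h \<in> fiber_group n c" and P: "\<forall>A\<in>P. h ` A = A"
    show "h x = id x"
    proof (cases "x \<in> {1..n}")
      case True
      then obtain A where A: "A \<in> P" "x \<in> A" using partition_onD1[OF assms] by blast
      then have "h x \<in> A" using P by blast
      moreover have "c (h x) = c x" using h True by (simp add: fiber_group_def)
      ultimately show ?thesis using A inj by (metis id_apply inj_onD)
    next
      case False
      then show ?thesis using h by (auto simp: fiber_group_def permutes_def)
    qed
  qed
qed

lemma consumption_ge_imp_sum_min_le:
  assumes "L \<in> int_partitions n" "consumption_ge n L M"
  shows "(\<Sum>a\<in>#L. min a k) \<le> (\<Sum>a\<in>#M. min a k)"
proof -
  obtain P where P: "partition_on {1..n} P" "block_sizes P = L"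
    using ex_partition_on_block_sizes[of "{1..n}" L] assms(1) by (auto simp: int_partitions_def)
  obtain c where c: "\<And>A. A \<in> P \<Longrightarrow> bij_betw c A {0..<card A}"
    using ex_bij_betw_blocks[OF _ P(1)] by auto
  have "consumes n (fiber_group n c) L"
    using P c distinguishes_fiber_group_iff[OF P(1)] unfolding consumes_def
    by (blast intro: bij_betw_imp_inj_on)
  then have "consumes n (fiber_group n c) M"
    using assms(2) subgroup_fiber_group by (auto simp: consumption_ge_def)
  then obtain R where R: "partition_on {1..n} R" "block_sizes R = M" "\<And>A. A \<in> R \<Longrightarrow> inj_on c A"
    unfolding consumes_def using distinguishes_fiber_group_iff by blast
  \<comment> \<open>Columns are numbered from 0, so \<open>c x < k\<close> selects the first
    \<open>k\<close> of them.\<close>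
  have "card {x \<in> A. c x < k} = min (card A) k" if "A \<in> P" for A
  proof -
    have "inj_on c {x \<in> A. c x < k}"
      using c[OF that] by (auto simp: bij_betw_def inj_on_def)
    moreover have "c ` {x \<in> A. c x < k} = c ` A \<inter> {..<k}" by auto
    moreover have "c ` A \<inter> {..<k} = {0..<min (card A) k}"
      using c[OF that] by (auto simp: bij_betw_def)
    ultimately show ?thesis by (metis card_image card_atLeastLessThan diff_zero)
  qed
  then have "(\<Sum>a\<in>#L. min a k) = card {x \<in> {1..n}. c x < k}"
    unfolding P(2)[symmetric] sum_mset_block_sizes
    by (subst card_partition_on_Collect[OF _ P(1)]) auto
  also have "\<dots> = (\<Sum>A\<in>R. card {x \<in> A. c x < k})"
    by (rule card_partition_on_Collect[OF _ R(1)]) simp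
  also have "\<dots> \<le> (\<Sum>A\<in>R. min (card A) k)"
  proof (rule sum_mono)
    fix A assume "A \<in> R"
    then have "finite A"
      using R(1) by (metis Union_upper finite_atLeastAtMost finite_subset partition_onD1)
    then have "card {x \<in> A. c x < k} \<le> card A" by (auto intro: card_mono)
    \<comment> \<open>A block of \<open>R\<close> has at most one cell in each column.\<close>
    moreover have "card {x \<in> A. c x < k} \<le> card {..<k}"
      using R(3)[OF \<open>A \<in> R\<close>] by (intro card_inj_on_le[of c]) (auto simp: inj_on_def)
    ultimately show "card {x \<in> A. c x < k} \<le> min (card A) k" by simp
  qed
  also have "\<dots> = (\<Sum>a\<in>#M. min a k)"
    unfolding R(2)[symmetric] sum_mset_block_sizes ..
  finally show ?thesis .
qed

text \<open>Passing from \<open>k\<close> to \<open>Suc k\<close> raises \<open>min a k\<close> by 1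
  if \<open>k < a\<close> and leaves it unchanged otherwise.\<close>

lemma sum_mset_min_Suc:
  "(\<Sum>a\<in>#L. min a (Suc k)) = (\<Sum>a\<in>#L. min a k) + size (filter_mset (\<lambda>a. k < a) L)"
  by (induction L) auto

lemma size_filter_less_Suc:
  "size (filter_mset (\<lambda>a. k < a) L) = size (filter_mset (\<lambda>a. Suc k < a) L) + count L (Suc k)"
  by (induction L) auto

lemma multiset_eq_if_sum_min_eq:
  fixes L M :: "nat multiset"
  assumes "0 \<notin># L" "0 \<notin># M" "\<And>k. (\<Sum>a\<in>#L. min a k) = (\<Sum>a\<in>#M. min a k)"
  shows "L = M"
proof (rule multiset_eqI)
  fix a
  have "size (filter_mset (\<lambda>a. k < a) L) = size (filter_mset (\<lambda>a. k < a) M)" for k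
    using assms(3)[of k] assms(3)[of "Suc k"] by (simp add: sum_mset_min_Suc)
  then have "count L (Suc k) = count M (Suc k)" for k
    using size_filter_less_Suc[of k L] size_filter_less_Suc[of k M] by simp
  \<comment> \<open>The differences only control the counts of positive numbers; for
    \<open>a = 0\<close> both counts vanish by assumption.\<close>
  then show "count L a = count M a"
    using assms(1,2) by (cases a) (auto simp: not_in_iff)
qed

theorem corollary5p5:
  fixes n :: nat
  assumes "n \<ge> 1"
  shows "partial_order_on (int_partitions n) (relation_of (consumption_ge n) (int_partitions n))"
proof (rule partial_order_on_relation_ofI)
  fix L M
  assume "L \<in> int_partitions n" "M \<in> int_partitions n"
    and "consumption_ge n L M" "consumption_ge n M L"
  then show "L = M"
    by (intro multiset_eq_if_sum_min_eq antisym consumption_ge_imp_sum_min_le)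
       (auto simp: int_partitions_def)
\<comment> \<open>Reflexivity and transitivity are those of implication, for each \<open>H\<close>
  separately.\<close>
qed (auto simp: consumption_ge_def)

end
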